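(* Let $n\ge1$, let $\varrho:[0,1]\to[0,\infty)$ be integrable with $\int_0^1\varrho(x)\,dx=1$, and let the angles $\theta_w$ and $\theta=\theta_\emptyset$ be as defined in the context. Define $\mathsf{U}_1:=\mathsf{I}_{2^{n-1}}\otimes\mathsf{R}(\theta)$ and, for $2\le j\le n$, \[ \mathsf{U}_j:=\prod_{w\in\{0,1\}^{j-1}}\Bigl(\mathsf{I}_{2^{n-j}}\otimes \mathsf{CC}^{(1)}_w\bigl(\mathsf{R}(\theta_w)\bigr)\Bigr), \] and let $|\psi_j\rangle:=\mathsf{U}_j\mathsf{U}_{j-1}\cdots\mathsf{U}_1|0\rangle^{\otimes n}$. Then for every $1\le j\le n$, \[ |\psi_j\rangle=|0\rangle^{\otimes(n-j)}\otimes\sum_{w=z_{n-j+1}\cdots z_n\in\{0,1\}^j}\Bigl(\mathsf{T}_{z_{n-j+1}}(\theta_{z_{n-j+2}\cdots z_n})\cdots\mathsf{T}_{z_{n-1}}(\theta_{z_n})\,\mathsf{T}_{z_n}(\theta)\Bigr)|w\rangle . \] In particular, $|\psi_n\rangle=\sum_{z_1\cdots z_n\in\{0,1\}^n}\bigl(\mathsf{T}_{z_1}(\theta_{z_2\cdots z_n})\cdots\mathsf{T}_{z_n}(\theta)\bigr)|z_1\cdots z_n\rangle$.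
   Context: The $n$-qubit space is $(\mathbb{C}^2)^{\otimes n}$ with basis $|z_1\cdots z_n\rangle=|z_1\rangle\otimes\cdots\otimes|z_n\rangle$ (qubit $1$ leftmost). $\mathsf{R}(\alpha)=\begin{pmatrix}\cos\alpha&-\sin\alpha\\ \sin\alpha&\cos\alpha\end{pmatrix}$, and $\mathsf{I}_d$ is the $d\times d$ identity. For $w\in\{0,1\}^{j-1}$, $\mathsf{CC}^{(1)}_w(U)\in\mathrm{U}(2^j)$ is the unitary on $j$ qubits that applies the one-qubit unitary $U$ to the first of these $j$ qubits if the remaining $j-1$ qubits are in the basis state $|w\rangle$, and acts as the identity on all other computational basis states; thus $\mathsf{I}_{2^{n-j}}\otimes\mathsf{CC}^{(1)}_w(U)$ acts on qubit $n-j+1$ controlled by qubits $n-j+2,\dots,n$. For a word $w=z_1\cdots z_m\in\{0,1\}^m$ ($m\ge0$) let $k(w)=\sum_{r=1}^m z_r2^{r-1}$, $I_w=[k(w)/2^m,(k(w)+1)/2^m]$, $p_w=\int_{I_w}\varrho(x)\,dx$; $0w,1w$ denote prepending a bit. For words $w$ of length $0\le m\le n-1$, $\theta_w\in[0,\pi/2]$ is defined by $\cos^2\theta_w=p_{0w}/p_w$, $\sin^2\theta_w=p_{1w}/p_w$ if $p_w>0$, and $\theta_w:=0$ if $p_w=0$; $\theta:=\theta_\emptyset$. For $z\in\{0,1\}$, $\mathsf{T}_z(x):=(\cos x)^{1-z}(\sin x)^z$. *)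

theory Defs
  imports "HOL-Analysis.Henstock_Kurzweil_Integration" "Jordan_Normal_Form.Matrix"
begin

section \<open>Linear-algebra infrastructure (complex matrices/vectors)\<close>

text \<open>Kronecker product of matrices and of vectors (standard convention:
the left factor is the most significant one).\<close>
definition kron :: "complex mat \<Rightarrow> complex mat \<Rightarrow> complex mat" where
  "kron A B = mat (dim_row A * dim_row B) (dim_col A * dim_col B)
     (\<lambda>(i, j). A $$ (i div dim_row B, j div dim_col B) * B $$ (i mod dim_row B, j mod dim_col B))"

definition kron_vec :: "complex vec \<Rightarrow> complex vec \<Rightarrow> complex vec" where
  "kron_vec u v = vec (dim_vec u * dim_vec v) (\<lambda>i. u $ (i div dim_vec v) * v $ (i mod dim_vec v))"

text \<open>One-qubit basis ket |z>, z = False ~ 0, z = True ~ 1.\<close>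
definition ket1 :: "bool \<Rightarrow> complex vec" where
  "ket1 b = vec 2 (\<lambda>i. if i = of_bool b then 1 else 0)"

text \<open>|z_1 ... z_m> = |z_1> (x) ... (x) |z_m> (qubit 1 leftmost).\<close>
fun ket :: "bool list \<Rightarrow> complex vec" where
  "ket [] = vec 1 (\<lambda>_. 1)"
| "ket (b # w) = kron_vec (ket1 b) (ket w)"

text \<open>Outer product |u><v|.\<close>
definition outer :: "complex vec \<Rightarrow> complex vec \<Rightarrow> complex mat" where
  "outer u v = mat (dim_vec u) (dim_vec v) (\<lambda>(i, j). u $ i * cnj (v $ j))"

text \<open>Finite sum of vectors of dimension d, indexed by a set.\<close>
definition vec_sum :: "nat \<Rightarrow> ('a \<Rightarrow> complex vec) \<Rightarrow> 'a set \<Rightarrow> complex vec" where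
  "vec_sum d f A = vec d (\<lambda>i. \<Sum>a\<in>A. f a $ i)"

text \<open>Rotation R(alpha).\<close>
definition Rot :: "real \<Rightarrow> complex mat" where
  "Rot \<alpha> = mat 2 2 (\<lambda>(i, j).
     if i = 0 \<and> j = 0 then complex_of_real (cos \<alpha>)
     else if i = 0 \<and> j = 1 then complex_of_real (- sin \<alpha>)
     else if i = 1 \<and> j = 0 then complex_of_real (sin \<alpha>)
     else complex_of_real (cos \<alpha>))"

text \<open>CC^(1)_w(U) on j = |w|+1 qubits: applies U to the first qubit if the
remaining |w| qubits are in |w>, identity on all other basis states.\<close>
definition CC1 :: "bool list \<Rightarrow> complex mat \<Rightarrow> complex mat" where
  "CC1 w U = kron U (outer (ket w) (ket w))
           + kron (1\<^sub>m 2) (1\<^sub>m (2 ^ length w) - outer (ket w) (ket w))"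

section \<open>Words, probabilities and angles\<close>

text \<open>k(w) = sum_r z_r 2^(r-1) for w = z_1 ... z_m (list index r-1).\<close>
definition kw :: "bool list \<Rightarrow> nat" where
  "kw w = (\<Sum>r<length w. of_bool (w ! r) * 2 ^ r)"

definition Iw :: "bool list \<Rightarrow> real set" where
  "Iw w = {real (kw w) / 2 ^ length w .. (real (kw w) + 1) / 2 ^ length w}"

definition pw :: "(real \<Rightarrow> real) \<Rightarrow> bool list \<Rightarrow> real" where
  "pw \<rho> w = integral (Iw w) \<rho>"

definition theta :: "(real \<Rightarrow> real) \<Rightarrow> bool list \<Rightarrow> real" where
  "theta \<rho> w = (if pw \<rho> w > 0 then
      (THE t. 0 \<le> t \<and> t \<le> pi / 2 \<and> (cos t)\<^sup>2 = pw \<rho> (False # w) / pw \<rho> w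
                \<and> (sin t)\<^sup>2 = pw \<rho> (True # w) / pw \<rho> w)
    else 0)"

definition T :: "bool \<Rightarrow> real \<Rightarrow> real" where
  "T z x = (cos x) ^ (1 - of_bool z) * (sin x) ^ (of_bool z)"

section \<open>The circuit\<close>

text \<open>U_1 = I_{2^(n-1)} (x) R(theta); for 2 <= j <= n,
U_j = product over w in {0,1}^(j-1) of I_{2^(n-j)} (x) CC^(1)_w(R(theta_w)).
The factors commute; we multiply them in the order of List.n_lists.\<close>
definition Ugate :: "(real \<Rightarrow> real) \<Rightarrow> nat \<Rightarrow> nat \<Rightarrow> complex mat" where
  "Ugate \<rho> n j = (if j = 1 then kron (1\<^sub>m (2 ^ (n - 1))) (Rot (theta \<rho> []))
     else foldr (\<lambda>w M. kron (1\<^sub>m (2 ^ (n - j))) (CC1 w (Rot (theta \<rho> w))) * M)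
                (List.n_lists (j - 1) [False, True]) (1\<^sub>m (2 ^ n)))"

text \<open>psi_j = U_j U_{j-1} ... U_1 |0>^(x)n.\<close>
fun psi :: "(real \<Rightarrow> real) \<Rightarrow> nat \<Rightarrow> nat \<Rightarrow> complex vec" where
  "psi \<rho> n 0 = ket (replicate n False)"
| "psi \<rho> n (Suc j) = mult_mat_vec (Ugate \<rho> n (Suc j)) (psi \<rho> n j)"

text \<open>Amplitude T_{y_1}(theta_{y_2...y_j}) ... T_{y_{j-1}}(theta_{y_j}) T_{y_j}(theta)
for w = y_1 ... y_j.\<close>
definition amp :: "(real \<Rightarrow> real) \<Rightarrow> bool list \<Rightarrow> real" where
  "amp \<rho> w = (\<Prod>i<length w. T (w ! i) (theta \<rho> (drop (Suc i) w)))"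

end

(*
  Number the computational basis by the big-endian value of a word, so that amplitudes of a
  j-qubit state form a vector of length 2^j. The claim is that after j layers the state is
  |0...0> (x) phi_j, where phi_j lists the amplitudes amp w of the words w of length j.
  The layer U_(j+1) is I (x) B on this product, so it acts as B on |0> (x) phi_j.  B is a
  product of rotations controlled by the distinct words w of length j; each one only mixes
  the coordinates 0w and 1w, and since the coordinate 1w of |0> (x) phi_j vanishes, it sends
  the amplitude of w to cos theta_w and sin theta_w times it.  This is exactly the recursion
  amp (z # w) = T z (theta w) * amp w.
*)
theory Submission
  imports Defs
begin

lemma eq_mult_add_iff_div_mod:
  fixes i K :: nat
  assumes "l < K"
  shows "i = c * K + l \<longleftrightarrow> i div K = c \<and> i mod K = l"
  using assms div_mult_mod_eq[of i K] by auto

lemma mod_mult_div_eq: "(m::nat) mod (q * n) div n = m div n mod q"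
proof (cases "n = 0")
  case False
  then show ?thesis
    using mod_mult2_eq[of m n q] by (simp add: mult.commute)
qed simp

lemma mult_add_less_mult: "h < H \<Longrightarrow> k < D \<Longrightarrow> h * D + k < H * (D :: nat)"
proof -
  assume "h < H" "k < D"
  then have "h * D + k < (h + 1) * D" by simp
  also have "\<dots> \<le> H * D" using \<open>h < H\<close> by (intro mult_right_mono) simp_all
  finally show ?thesis .
qed

lemma sum_lessThan_mult_split: "(\<Sum>k<H * D. f k) = (\<Sum>h<H. \<Sum>k<D. f (h * D + k :: nat))"
  by (simp add: sum.nat_group[symmetric] sum.atLeastLessThan_shift_0[of _ "_ * D"] atLeast0LessThan comp_def)

lemma pow_diff_mult_pow: "k \<le> n \<Longrightarrow> (2::nat) ^ (n - k) * 2 ^ k = 2 ^ n"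
  by (simp add: power_add[symmetric])

fun ket_index :: "bool list \<Rightarrow> nat" where
  "ket_index [] = 0"
| "ket_index (b # w) = of_bool b * 2 ^ length w + ket_index w"

fun ket_word :: "nat \<Rightarrow> nat \<Rightarrow> bool list" where
  "ket_word 0 i = []"
| "ket_word (Suc m) i = odd (i div 2 ^ m) # ket_word m (i mod 2 ^ m)"

lemma ket_index_less: "ket_index w < 2 ^ length w"
  by (induction w) auto

lemma length_ket_word [simp]: "length (ket_word m i) = m"
  by (induction m arbitrary: i) auto

lemma ket_index_ket_word: "i < 2 ^ m \<Longrightarrow> ket_index (ket_word m i) = i"
proof (induction m arbitrary: i)
  case (Suc m)
  then have "i div 2 ^ m < 2"
    by (simp add: less_mult_imp_div_less)
  then have "of_bool (odd (i div 2 ^ m)) = i div 2 ^ m"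
    by (auto simp: less_2_cases_iff)
  then show ?case
    using Suc.IH[of "i mod 2 ^ m"] by (simp add: div_mult_mod_eq)
qed simp

lemma ket_word_ket_index: "ket_word (length w) (ket_index w) = w"
  using ket_index_less by (induction w) auto

lemma dim_ket [simp]: "dim_vec (ket w) = 2 ^ length w"
  by (induction w) (auto simp: kron_vec_def ket1_def)

lemma index_ket: "i < 2 ^ length w \<Longrightarrow> ket w $ i = (if i = ket_index w then 1 else 0)"
proof (induction w arbitrary: i)
  case (Cons b w)
  have "i div 2 ^ length w < 2"
    using Cons.prems by (simp add: less_mult_imp_div_less)
  moreover have "i = ket_index (b # w) \<longleftrightarrow>
      i div 2 ^ length w = of_bool b \<and> i mod 2 ^ length w = ket_index w"
    using eq_mult_add_iff_div_mod[OF ket_index_less] by simp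
  ultimately show ?case
    using Cons by (auto simp: kron_vec_def ket1_def)
qed simp

lemma vec_sum_ket_expansion:
  "vec_sum (2 ^ j) (\<lambda>w. f w \<cdot>\<^sub>v ket w) {w. length w = j} = vec (2 ^ j) (\<lambda>i. f (ket_word j i))"
proof (rule eq_vecI)
  fix i
  assume "i < dim_vec (vec (2 ^ j) (\<lambda>i. f (ket_word j i)))"
  then have i: "i < 2 ^ j"
    by simp
  have "finite {w :: bool list. length w = j}"
    using finite_lists_length_eq[of "UNIV :: bool set" j] by simp
  moreover have "(\<Sum>w\<in>{w. length w = j}. (f w \<cdot>\<^sub>v ket w) $ i)
      = (\<Sum>w\<in>{w. length w = j}. if w = ket_word j i then f w else 0)"
  proof (rule sum.cong)
    fix w :: "bool list"
    assume "w \<in> {w. length w = j}"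
    then show "(f w \<cdot>\<^sub>v ket w) $ i = (if w = ket_word j i then f w else 0)"
      using i index_ket[of i w] ket_index_ket_word[OF i] ket_word_ket_index[of w] by auto
  qed simp
  ultimately show "vec_sum (2 ^ j) (\<lambda>w. f w \<cdot>\<^sub>v ket w) {w. length w = j} $ i = vec (2 ^ j) (\<lambda>i. f (ket_word j i)) $ i"
    using i by (simp add: vec_sum_def sum.delta')
qed (simp add: vec_sum_def)

lemma dim_ket1 [simp]: "dim_vec (ket1 b) = 2"
  by (simp add: ket1_def)

lemma dim_kron_vec [simp]: "dim_vec (kron_vec x y) = dim_vec x * dim_vec y"
  by (simp add: kron_vec_def)

lemma index_kron_vec:
  "i < dim_vec x * dim_vec y \<Longrightarrow> kron_vec x y $ i = x $ (i div dim_vec y) * y $ (i mod dim_vec y)"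
  by (simp add: kron_vec_def)

lemma kron_vec_assoc: "kron_vec (kron_vec x y) z = kron_vec x (kron_vec y z)"
proof (rule eq_vecI)
  fix i
  assume "i < dim_vec (kron_vec x (kron_vec y z))"
  then have i: "i < dim_vec x * dim_vec y * dim_vec z"
    by (simp add: mult.assoc)
  have y: "0 < dim_vec y" and z: "0 < dim_vec z"
    using i by (auto intro: gr0I)
  then have "i div dim_vec z < dim_vec x * dim_vec y" and "i mod (dim_vec y * dim_vec z) < dim_vec y * dim_vec z"
    using i by (simp_all add: less_mult_imp_div_less)
  moreover have "i mod (dim_vec y * dim_vec z) div dim_vec z = i div dim_vec z mod dim_vec y"
    by (rule mod_mult_div_eq)
  moreover have "i div (dim_vec y * dim_vec z) = i div dim_vec z div dim_vec y"
    using div_mult2_eq[of i "dim_vec z" "dim_vec y"] by (simp add: mult.commute)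
  ultimately show "kron_vec (kron_vec x y) z $ i = kron_vec x (kron_vec y z) $ i"
    using i by (simp add: index_kron_vec mult.assoc mod_mod_cancel)
qed (simp add: mult.assoc)

lemma kron_vec_ket_Nil: "kron_vec (ket []) y = y"
  by (rule eq_vecI) (simp_all add: kron_vec_def)

lemma ket_append: "ket (u @ v) = kron_vec (ket u) (ket v)"
  by (induction u) (simp_all del: ket.simps(1) add: kron_vec_ket_Nil kron_vec_assoc)

lemma kron_carrier:
  "A \<in> carrier_mat m n \<Longrightarrow> B \<in> carrier_mat p q \<Longrightarrow> kron A B \<in> carrier_mat (m * p) (n * q)"
  by (simp add: kron_def)

lemma kron_one_mat_mult_kron_vec:
  assumes B: "B \<in> carrier_mat D D" and y: "y \<in> carrier_vec D"
  shows "kron (1\<^sub>m (dim_vec x)) B *\<^sub>v kron_vec x y = kron_vec x (B *\<^sub>v y)"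
proof (rule eq_vecI)
  let ?H = "dim_vec x"
  have dims: "dim_row B = D" "dim_col B = D" "dim_vec y = D"
    using B y by auto
  fix i
  assume "i < dim_vec (kron_vec x (B *\<^sub>v y))"
  then have i: "i < ?H * D"
    using B by simp
  then have D: "0 < D" and h: "i div D < ?H"
    by (auto intro: gr0I simp: less_mult_imp_div_less)
  have "(kron (1\<^sub>m ?H) B *\<^sub>v kron_vec x y) $ i
      = (\<Sum>k<?H * D. kron (1\<^sub>m ?H) B $$ (i, k) * kron_vec x y $ k)"
    using B y i by (simp add: kron_def scalar_prod_def atLeast0LessThan)
  also have "\<dots> = (\<Sum>h<?H. \<Sum>k<D. (if h = i div D then B $$ (i mod D, k) * (x $ h * y $ k) else 0))"
    by (rule trans[OF sum_lessThan_mult_split], intro sum.cong refl)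
      (simp add: kron_def index_kron_vec mult_add_less_mult dims i D h)
  also have "\<dots> = x $ (i div D) * (\<Sum>k<D. B $$ (i mod D, k) * y $ k)"
    using h by (subst sum.swap) (simp add: sum.delta' sum_distrib_left ac_simps)
  also have "\<dots> = kron_vec x (B *\<^sub>v y) $ i"
    using i D dims by (simp add: index_kron_vec scalar_prod_def atLeast0LessThan)
  finally show "(kron (1\<^sub>m ?H) B *\<^sub>v kron_vec x y) $ i = kron_vec x (B *\<^sub>v y) $ i" .
qed (use B in \<open>simp add: kron_def\<close>)

lemma foldr_mult_mat_carrier:
  "set As \<subseteq> carrier_mat n n \<Longrightarrow> foldr (*) As (1\<^sub>m n) \<in> carrier_mat n n"
  by (induction As) auto

lemma foldr_mult_mat_vec_carrier:
  "set As \<subseteq> carrier_mat n n \<Longrightarrow> v \<in> carrier_vec n \<Longrightarrow>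
    foldr (*\<^sub>v) As v \<in> carrier_vec n"
  by (induction As) auto

lemma foldr_mult_mat_vec:
  fixes As :: "'a :: semiring_1 mat list"
  assumes "set As \<subseteq> carrier_mat n n" and "v \<in> carrier_vec n"
  shows "foldr (*) As (1\<^sub>m n) *\<^sub>v v = foldr (*\<^sub>v) As v"
  using assms
proof (induction As)
  case (Cons A As)
  then show ?case
    using assoc_mult_mat_vec[of A n n "foldr (*) As (1\<^sub>m n)" n v] by (simp add: foldr_mult_mat_carrier)
qed simp

lemma foldr_kron_one_mat_mult_kron_vec:
  assumes "set Bs \<subseteq> carrier_mat D D" and "y \<in> carrier_vec D"
  shows "foldr (*\<^sub>v) (map (kron (1\<^sub>m (dim_vec x))) Bs) (kron_vec x y) = kron_vec x (foldr (*\<^sub>v) Bs y)"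
  using assms
proof (induction Bs)
  case (Cons B Bs)
  then show ?case
    using kron_one_mat_mult_kron_vec[of B D "foldr (*\<^sub>v) Bs y"] by (simp add: foldr_mult_mat_vec_carrier)
qed simp

lemma CC1_carrier: "R \<in> carrier_mat 2 2 \<Longrightarrow> CC1 w R \<in> carrier_mat (2 * 2 ^ length w) (2 * 2 ^ length w)"
  by (simp add: CC1_def kron_def outer_def)

lemma index_CC1:
  fixes R :: "complex mat" and w :: "bool list"
  defines "K \<equiv> 2 ^ length w"
  assumes R: "R \<in> carrier_mat 2 2" and a: "a < 2 * K" and b: "b < 2 * K"
  shows "CC1 w R $$ (a, b) =
    (if a mod K = ket_index w then (if b mod K = ket_index w then R $$ (a div K, b div K) else 0)
     else of_bool (a = b))"
proof -
  have "a div K < 2" "b div K < 2" "a mod K < K" "b mod K < K"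
    using a b by (simp_all add: less_mult_imp_div_less K_def)
  moreover have "a = b \<longleftrightarrow> a div K = b div K \<and> a mod K = b mod K"
    by (metis div_mult_mod_eq)
  ultimately show ?thesis
    using R a b by (auto simp: CC1_def kron_def outer_def index_ket K_def)
qed

lemma CC1_Nil:
  assumes R: "R \<in> carrier_mat 2 2"
  shows "CC1 [] R = R"
proof (rule eq_matI)
  fix a b
  assume "a < dim_row R" "b < dim_col R"
  then show "CC1 [] R $$ (a, b) = R $$ (a, b)"
    using R index_CC1[OF R, where w="[]" and a=a and b=b] by simp
qed (use CC1_carrier[OF R, of "[]"] R in auto)

lemma CC1_layer_carrier:
  assumes "set L \<subseteq> {w. length w = m}" and "\<And>w. R w \<in> carrier_mat 2 2"
  shows "set (map (\<lambda>w. CC1 w (R w)) L) \<subseteq> carrier_mat (2 * 2 ^ m) (2 * 2 ^ m)"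
proof clarsimp
  fix w
  assume "w \<in> set L"
  then show "CC1 w (R w) \<in> carrier_mat (2 * 2 ^ m) (2 * 2 ^ m)"
    using assms CC1_carrier[of "R w" w] by auto
qed

lemma CC1_mult_vec:
  fixes R :: "complex mat" and w :: "bool list"
  defines "K \<equiv> 2 ^ length w"
  assumes R: "R \<in> carrier_mat 2 2" and v: "v \<in> carrier_vec (2 * K)" and a: "a < 2 * K"
  shows "(CC1 w R *\<^sub>v v) $ a =
    (if a mod K = ket_index w
     then R $$ (a div K, 0) * v $ ket_index w + R $$ (a div K, 1) * v $ (K + ket_index w)
     else v $ a)"
proof -
  have K: "0 < K"
    by (simp add: K_def)
  have "CC1 w R \<in> carrier_mat (2 * K) (2 * K)"
    using CC1_carrier[OF R] by (simp add: K_def)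
  then have sum_eq: "(CC1 w R *\<^sub>v v) $ a = (\<Sum>b<2 * K. CC1 w R $$ (a, b) * v $ b)"
    using v a by (simp add: scalar_prod_def atLeast0LessThan)
  show ?thesis
  proof (cases "a mod K = ket_index w")
    case True
    have "(\<Sum>b<2 * K. CC1 w R $$ (a, b) * v $ b) = (\<Sum>h<2. \<Sum>k<K. CC1 w R $$ (a, h * K + k) * v $ (h * K + k))"
      by (rule sum_lessThan_mult_split)
    also have "\<dots> = (\<Sum>h<2. R $$ (a div K, h) * v $ (h * K + ket_index w))"
    proof (intro sum.cong refl)
      fix h :: nat
      assume "h \<in> {..<2}"
      then have entry: "CC1 w R $$ (a, h * K + k) = (if k = ket_index w then R $$ (a div K, h) else 0)"
        if "k < K" for k
        using index_CC1[OF R, where a=a and b="h * K + k"] True that a K mult_add_less_mult[of h 2 k K]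
        by (simp add: K_def)
      have "(\<Sum>k<K. CC1 w R $$ (a, h * K + k) * v $ (h * K + k))
          = (\<Sum>k<K. if k = ket_index w then R $$ (a div K, h) * v $ (h * K + k) else 0)"
        by (rule sum.cong) (simp_all add: entry)
      then show "(\<Sum>k<K. CC1 w R $$ (a, h * K + k) * v $ (h * K + k)) = R $$ (a div K, h) * v $ (h * K + ket_index w)"
        using ket_index_less[of w] by (simp add: K_def sum.delta')
    qed
    also have "\<dots> = R $$ (a div K, 0) * v $ ket_index w + R $$ (a div K, 1) * v $ (K + ket_index w)"
      by (simp add: numeral_2_eq_2)
    finally show ?thesis
      using True sum_eq by simp
  next
    case False
    then have "CC1 w R $$ (a, b) = of_bool (a = b)" if "b < 2 * K" for b
      using index_CC1[OF R, where a=a and b=b] a that by (simp add: K_def)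
    then show ?thesis
      using False sum_eq a by (simp add: sum.delta)
  qed
qed

lemma foldr_CC1_mult_vec:
  fixes R :: "bool list \<Rightarrow> complex mat" and m :: nat
  defines "K \<equiv> 2 ^ m"
  assumes L: "distinct L" "set L \<subseteq> {w. length w = m}"
    and R: "\<And>w. R w \<in> carrier_mat 2 2" and v: "v \<in> carrier_vec (2 * K)" and a: "a < 2 * K"
  shows "foldr (*\<^sub>v) (map (\<lambda>w. CC1 w (R w)) L) v $ a =
    (if ket_word m (a mod K) \<in> set L
     then R (ket_word m (a mod K)) $$ (a div K, 0) * v $ (a mod K)
        + R (ket_word m (a mod K)) $$ (a div K, 1) * v $ (K + a mod K)
     else v $ a)"
  using L a
proof (induction L arbitrary: a)
  case (Cons w L)
  let ?V = "foldr (*\<^sub>v) (map (\<lambda>w. CC1 w (R w)) L) v"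
  have w: "length w = m" "w \<notin> set L"
    using Cons.prems by auto
  have "set (map (\<lambda>w. CC1 w (R w)) L) \<subseteq> carrier_mat (2 * K) (2 * K)"
    using Cons.prems R unfolding K_def by (intro CC1_layer_carrier) auto
  then have V: "?V \<in> carrier_vec (2 * K)"
    using v by (rule foldr_mult_mat_vec_carrier)
  have K: "0 < K"
    by (simp add: K_def)
  \<comment> \<open>Gates with distinct controls act on disjoint pairs of coordinates.\<close>
  have unchanged: "?V $ b = v $ b" if "b < 2 * K" "b mod K = ket_index w" for b
    using Cons.IH[of b] Cons.prems that w ket_word_ket_index[of w] by (simp add: K_def)
  show ?case
  proof (cases "a mod K = ket_index w")
    case True
    then have "ket_word m (a mod K) = w"
      using ket_word_ket_index[of w] w by simp
    moreover have "ket_index w < K"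
      using ket_index_less[of w] w by (simp add: K_def)
    ultimately show ?thesis
      using CC1_mult_vec[OF R V[unfolded K_def, folded w(1)]] Cons.prems True unchanged
      by (simp add: K_def w)
  next
    case False
    then have "ket_word m (a mod K) \<noteq> w"
      using ket_index_ket_word[of "a mod K" m] K by (auto simp: K_def)
    then show ?thesis
      using CC1_mult_vec[OF R V[unfolded K_def, folded w(1)]] Cons.prems False Cons.IH[of a]
      by (simp add: K_def w)
  qed
qed simp

lemma Rot_carrier: "Rot x \<in> carrier_mat 2 2"
  by (simp add: Rot_def)

lemma index_Rot_0: "q < 2 \<Longrightarrow> Rot x $$ (q, 0) = complex_of_real (T (q = 1) x)"
  by (cases "q = 0") (auto simp: Rot_def T_def)

definition rotation_layer :: "(real \<Rightarrow> real) \<Rightarrow> nat \<Rightarrow> complex mat list" where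
  "rotation_layer \<rho> m = map (\<lambda>w. CC1 w (Rot (theta \<rho> w))) (List.n_lists m [False, True])"

lemma rotation_layer_carrier: "set (rotation_layer \<rho> m) \<subseteq> carrier_mat (2 * 2 ^ m) (2 * 2 ^ m)"
  unfolding rotation_layer_def by (rule CC1_layer_carrier[OF _ Rot_carrier]) (auto simp: set_n_lists)

definition amp_state :: "(real \<Rightarrow> real) \<Rightarrow> nat \<Rightarrow> complex vec" where
  "amp_state \<rho> j = vec (2 ^ j) (\<lambda>i. complex_of_real (amp \<rho> (ket_word j i)))"

lemma dim_amp_state [simp]: "dim_vec (amp_state \<rho> j) = 2 ^ j"
  by (simp add: amp_state_def)

lemma amp_state_0: "amp_state \<rho> 0 = ket []"
  by (rule eq_vecI) (simp_all add: amp_state_def amp_def)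

lemma amp_Cons: "amp \<rho> (b # w) = T b (theta \<rho> w) * amp \<rho> w"
  unfolding amp_def by (simp add: prod.lessThan_Suc_shift del: prod.lessThan_Suc)

lemma rotation_layer_mult_amp_state:
  "foldr (*\<^sub>v) (rotation_layer \<rho> m) (kron_vec (ket1 False) (amp_state \<rho> m)) = amp_state \<rho> (Suc m)"
proof (rule eq_vecI)
  let ?K = "2 ^ m :: nat"
  let ?L = "List.n_lists m [False, True]"
  let ?v = "kron_vec (ket1 False) (amp_state \<rho> m)"
  have L: "distinct ?L" "set ?L \<subseteq> {w. length w = m}"
    by (auto simp: distinct_n_lists set_n_lists)
  have v: "?v \<in> carrier_vec (2 * ?K)"
    by (intro carrier_vecI) simp
  then show "dim_vec (foldr (*\<^sub>v) (rotation_layer \<rho> m) ?v) = dim_vec (amp_state \<rho> (Suc m))"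
    using foldr_mult_mat_vec_carrier[OF rotation_layer_carrier] by simp
  fix a
  assume "a < dim_vec (amp_state \<rho> (Suc m))"
  then have a: "a < 2 * ?K"
    by simp
  let ?w = "ket_word m (a mod ?K)"
  have "a mod ?K < ?K"
    by simp
  then have "a mod ?K < dim_vec (ket1 False) * dim_vec (amp_state \<rho> m)"
      "?K + a mod ?K < dim_vec (ket1 False) * dim_vec (amp_state \<rho> m)"
    by (simp_all only: dim_ket1 dim_amp_state)
  then have "?v $ (a mod ?K) = complex_of_real (amp \<rho> ?w)" "?v $ (?K + a mod ?K) = 0"
    by (simp_all add: index_kron_vec ket1_def amp_state_def)
  moreover have "?w \<in> set ?L"
    by (simp add: set_n_lists UNIV_bool[symmetric])
  ultimately have "foldr (*\<^sub>v) (rotation_layer \<rho> m) ?v $ a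
      = Rot (theta \<rho> ?w) $$ (a div ?K, 0) * complex_of_real (amp \<rho> ?w)"
    using foldr_CC1_mult_vec[OF L Rot_carrier v a] by (simp add: rotation_layer_def)
  also have "\<dots> = amp_state \<rho> (Suc m) $ a"
  proof -
    have q: "a div ?K < 2"
      using a by (simp add: less_mult_imp_div_less)
    then have "odd (a div ?K) \<longleftrightarrow> a div ?K = 1"
      by (auto simp: less_2_cases_iff)
    then show ?thesis
      using a q by (simp add: index_Rot_0 amp_state_def amp_Cons)
  qed
  finally show "foldr (*\<^sub>v) (rotation_layer \<rho> m) ?v $ a = amp_state \<rho> (Suc m) $ a" .
qed

lemma Ugate_eq_foldr:
  assumes "Suc m \<le> n"
  shows "Ugate \<rho> n (Suc m) =
    foldr (*) (map (kron (1\<^sub>m (2 ^ (n - Suc m)))) (rotation_layer \<rho> m)) (1\<^sub>m (2 ^ n))"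
proof (cases m)
  case 0
  have "(2::nat) ^ (n - 1) * 2 = 2 ^ n"
    using pow_diff_mult_pow[of 1 n] assms 0 by simp
  then have "kron (1\<^sub>m (2 ^ (n - 1))) (Rot (theta \<rho> [])) \<in> carrier_mat (2 ^ n) (2 ^ n)"
    using kron_carrier[OF one_carrier_mat Rot_carrier, of "2 ^ (n - 1)" "theta \<rho> []"] by (simp only:)
  then show ?thesis
    using 0 by (simp add: Ugate_def rotation_layer_def CC1_Nil Rot_carrier)
qed (simp add: Ugate_def rotation_layer_def foldr_map comp_def)

lemma psi_eq_kron_amp_state:
  "j \<le> n \<Longrightarrow> psi \<rho> n j = kron_vec (ket (replicate (n - j) False)) (amp_state \<rho> j)"
proof (induction j)
  case 0
  then show ?case
    using ket_append[of "replicate n False" "[]"] by (simp add: amp_state_0 del: ket.simps(1))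
next
  case (Suc j)
  let ?x = "ket (replicate (n - Suc j) False)"
  let ?v = "kron_vec (ket1 False) (amp_state \<rho> j)"
  have dims: "dim_vec ?x * (2 * 2 ^ j) = 2 ^ n"
    using pow_diff_mult_pow[OF Suc.prems] by simp
  have "kron (1\<^sub>m (dim_vec ?x)) B \<in> carrier_mat (2 ^ n) (2 ^ n)" if "B \<in> set (rotation_layer \<rho> j)" for B
    using kron_carrier[OF one_carrier_mat, of B "2 * 2 ^ j" "2 * 2 ^ j" "dim_vec ?x"]
      rotation_layer_carrier that dims
    by auto
  then have layer: "set (map (kron (1\<^sub>m (dim_vec ?x))) (rotation_layer \<rho> j)) \<subseteq> carrier_mat (2 ^ n) (2 ^ n)"
    by auto
  have "n - j = Suc (n - Suc j)"
    using Suc.prems by simp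
  then have "replicate (n - j) False = replicate (n - Suc j) False @ [False]"
    by (simp only: replicate_Suc replicate_append_same)
  then have psi_j: "psi \<rho> n j = kron_vec ?x ?v"
    using Suc by (simp add: ket_append kron_vec_assoc kron_vec_ket_Nil del: ket.simps(1))
  then have "psi \<rho> n j \<in> carrier_vec (2 ^ n)"
    using dims by (intro carrier_vecI) simp
  then have "psi \<rho> n (Suc j) = foldr (*\<^sub>v) (map (kron (1\<^sub>m (dim_vec ?x))) (rotation_layer \<rho> j)) (psi \<rho> n j)"
    using Ugate_eq_foldr[OF Suc.prems, of \<rho>] foldr_mult_mat_vec[OF layer] by simp
  also have "\<dots> = kron_vec ?x (foldr (*\<^sub>v) (rotation_layer \<rho> j) ?v)"
    unfolding psi_j by (rule foldr_kron_one_mat_mult_kron_vec[OF rotation_layer_carrier], intro carrier_vecI) simp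
  also have "\<dots> = kron_vec ?x (amp_state \<rho> (Suc j))"
    by (simp only: rotation_layer_mult_amp_state)
  finally show ?case .
qed

theorem lemma3p2:
  fixes n :: nat and \<rho> :: "real \<Rightarrow> real"
  assumes "n \<ge> 1"
    and "\<forall>x\<in>{0..1}. \<rho> x \<ge> 0"
    and "\<rho> integrable_on {0..1}"
    and "integral {0..1} \<rho> = 1"
  shows "(\<forall>j\<in>{1..n}. psi \<rho> n j =
            kron_vec (ket (replicate (n - j) False))
              (vec_sum (2 ^ j) (\<lambda>w. complex_of_real (amp \<rho> w) \<cdot>\<^sub>v ket w)
                 {w. length w = j}))
       \<and> psi \<rho> n n = vec_sum (2 ^ n) (\<lambda>z. complex_of_real (amp \<rho> z) \<cdot>\<^sub>v ket z)
                 {z. length z = n}"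
proof -
  have amp_state_eq: "amp_state \<rho> j = vec_sum (2 ^ j) (\<lambda>w. complex_of_real (amp \<rho> w) \<cdot>\<^sub>v ket w) {w. length w = j}"
    for j
    by (simp add: vec_sum_ket_expansion amp_state_def)
  show ?thesis
    using psi_eq_kron_amp_state[of _ n \<rho>] psi_eq_kron_amp_state[of n n \<rho>]
    by (simp add: amp_state_eq kron_vec_ket_Nil del: ket.simps(1))
qed

end
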